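(* Let $V$ be an $n$-dimensional vector space over the finite field $\mathbb{F}_q$, where $q$ is a power of a prime $p$, regarded as a group under addition. Then: (1) If $q$ is even or $q \equiv 1 \pmod 4$, then $V$ admits a (continuous) inverse ambiguous function. (2) If $q \equiv 3 \pmod 4$, then $V$ admits a (continuous) inverse ambiguous function if and only if $n$ is even.
   Context: For a group $G$, a function $f : G \to G$ is called inverse ambiguous if it is bijective and its inverse function satisfies $f^{-1}(x) = (f(x))^{-1}$ for all $x \in G$, where the right-hand side is the group inverse of $f(x)$. Equivalently, $f(f(x)) = x^{-1}$ for all $x \in G$; for the additive group of $V$ this reads $f(f(v)) = -v$ for all $v \in V$. The function $f$ is not required to be linear. The finite group $V$ has the discrete topology, so continuity is automatic. *)

theory Defs
  imports Complex_Main "HOL-Library.Cardinality" "HOL-Analysis.Abstract_Topology" "HOL-Number_Theory.Cong"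
begin

text \<open>The class \<open>group_add\<close> covers arbitrary (not necessarily abelian) groups in additive
  notation, so \<open>- f x\<close> is the group inverse of \<open>f x\<close>, whereas \<open>inv f\<close> is the inverse function.\<close>

definition inverse_ambiguous :: "('a::group_add \<Rightarrow> 'a) \<Rightarrow> bool" where
  "inverse_ambiguous f \<longleftrightarrow> bij f \<and> (\<forall>x. inv f x = - f x)"

end

theory Submission
  imports Defs
begin

text \<open>A square root \<open>f\<close> of negation commutes with negation, so if negation fixes only \<open>0\<close>, then
  \<open>f 0 = 0\<close> and \<open>f\<close> permutes the nonzero elements in cycles of length four. Conversely, when the
  number of nonzero elements is divisible by four, such cycles can be formed by grouping the pairs
  \<open>{x, -x}\<close> two at a time. The criterion is thus \<open>q ^ n \<equiv> 1 (mod 4)\<close> for odd \<open>q\<close>, while for even \<open>q\<close>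
  negation is the identity.\<close>

text \<open>The sets \<open>{x, h x}\<close> partition \<open>S\<close> into pairs; the induction
  strips off one pair at a time.\<close>

lemma even_card_involution:
  assumes "finite S"
    and "\<And>x. x \<in> S \<Longrightarrow> h x \<in> S \<and> h (h x) = x \<and> h x \<noteq> x"
  shows "even (card S)"
  using assms
proof (induction S rule: finite_psubset_induct)
  case (psubset S)
  show ?case
  proof (cases "S = {}")
    case False
    then obtain x where x: "x \<in> S" by blast
    let ?T = "{x, h x}"
    have T: "?T \<subseteq> S" "card ?T = 2"
      using psubset.prems[OF x] x by auto
    have "even (card (S - ?T))"
    proof (rule psubset.IH)
      show "S - ?T \<subset> S" using x by auto
      show "h y \<in> S - ?T \<and> h (h y) = y \<and> h y \<noteq> y" if "y \<in> S - ?T" for y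
        using that psubset.prems[of y] psubset.prems[OF x] by auto
    qed
    moreover have "card S = card (S - ?T) + card ?T"
      using T psubset.hyps card_mono[OF psubset.hyps T(1)] by (simp add: card_Diff_subset)
    ultimately show ?thesis using T(2) by simp
  qed simp
qed

text \<open>Every orbit of \<open>f\<close> in \<open>S\<close> has length dividing 4 but not 2,
  hence exactly four elements. The induction removes one orbit at a time.\<close>

lemma four_dvd_card_order_four:
  assumes "finite S"
    and "\<And>x. x \<in> S \<Longrightarrow> f x \<in> S \<and> f (f (f (f x))) = x \<and> f (f x) \<noteq> x"
  shows "4 dvd card S"
  using assms
proof (induction S rule: finite_psubset_induct)
  case (psubset S)
  show ?case
  proof (cases "S = {}")
    case False
    then obtain x where x: "x \<in> S" by blast
    let ?T = "{x, f x, f (f x), f (f (f x))}"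
    have mem: "f x \<in> S" "f (f x) \<in> S" "f (f (f x)) \<in> S" and cyc: "f (f (f (f x))) = x"
      using x psubset.prems by blast+
    \<comment> \<open>Any coincidence in the cycle would make \<open>f (f z) = z\<close> for
      \<open>z = x\<close> or \<open>z = f x\<close>.\<close>
    have "distinct [x, f x, f (f x), f (f (f x))]"
      using psubset.prems[OF x] psubset.prems[OF mem(1)] cyc by simp metis
    then have T: "?T \<subseteq> S" "card ?T = 4"
      using x mem by auto
    have "4 dvd card (S - ?T)"
    proof (rule psubset.IH)
      show "S - ?T \<subset> S" using x by auto
      show "f y \<in> S - ?T \<and> f (f (f (f y))) = y \<and> f (f y) \<noteq> y" if "y \<in> S - ?T" for y
      proof -
        have y: "y \<in> S" "y \<notin> ?T" using that by auto
        then have "f (f (f (f y))) = y" using psubset.prems by blast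
        \<comment> \<open>If \<open>f y\<close> lay in the orbit, three more applications of
          \<open>f\<close> would put \<open>y\<close> there too.\<close>
        then have "f y \<notin> ?T" using y(2) cyc by auto
        then show ?thesis using psubset.prems[OF y(1)] by blast
      qed
    qed
    moreover have "card S = card (S - ?T) + card ?T"
      using T psubset.hyps card_mono[OF psubset.hyps T(1)] by (simp add: card_Diff_subset)
    ultimately show ?thesis using T(2) by simp
  qed simp
qed

text \<open>There is an even number of pairs \<open>{x, h x}\<close>, so they can be grouped two at
  a time; each group of two pairs is joined into one four-cycle whose square is
  \<open>h\<close>.\<close>

lemma involution_has_square_root:
  assumes "finite S" and "4 dvd card S"
    and "\<And>x. x \<in> S \<Longrightarrow> h x \<in> S \<and> h (h x) = x \<and> h x \<noteq> x"
  shows "\<exists>f. \<forall>x\<in>S. f x \<in> S \<and> f (f x) = h x"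
  using assms
proof (induction S rule: finite_psubset_induct)
  case (psubset S)
  show ?case
  proof (cases "S = {}")
    case False
    then obtain x where x: "x \<in> S" by blast
    \<comment> \<open>A nonempty \<open>S\<close> has at least four elements, so a second pair is
      available.\<close>
    have "card {x, h x} \<le> 2" by (simp add: card_insert_if)
    moreover have "card S \<ge> 4"
      using psubset.prems(1) psubset.hyps False by (simp add: card_gt_0_iff dvd_imp_le)
    ultimately have "\<not> S \<subseteq> {x, h x}"
      using card_mono[of "{x, h x}" S] by auto
    then obtain y where y: "y \<in> S" "y \<noteq> x" "y \<noteq> h x" by blast
    note hx = psubset.prems(2)[OF x] and hy = psubset.prems(2)[OF y(1)]
    let ?T = "{x, y, h x, h y}"
    have ne: "x \<noteq> h y" "h x \<noteq> h y" using hx hy y by metis+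
    have T: "?T \<subseteq> S" "card ?T = 4"
      using x y hx hy ne by (auto simp: card_insert_if)
    have "card S = card (S - ?T) + card ?T"
      using T psubset.hyps card_mono[OF psubset.hyps T(1)] by (simp add: card_Diff_subset)
    then have dvd: "4 dvd card (S - ?T)"
      using psubset.prems(1) T(2) by simp
    have "\<exists>f. \<forall>z\<in>S - ?T. f z \<in> S - ?T \<and> f (f z) = h z"
    proof (rule psubset.IH[OF _ dvd])
      show "S - ?T \<subset> S" using x by auto
      show "h z \<in> S - ?T \<and> h (h z) = z \<and> h z \<noteq> z" if "z \<in> S - ?T" for z
        using that psubset.prems(2)[of z] hx hy by auto
    qed
    then obtain f where f: "\<And>z. z \<in> S - ?T \<Longrightarrow> f z \<in> S - ?T \<and> f (f z) = h z" by blast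
    \<comment> \<open>The cycle interleaves the two pairs, so two steps along it lead from each
      element to its partner.\<close>
    let ?g = "f(x := y, y := h x, h x := h y, h y := x)"
    have "?g z \<in> S \<and> ?g (?g z) = h z" if z: "z \<in> S" for z
    proof (cases "z \<in> ?T")
      case True
      then show ?thesis using x y hx hy ne by auto
    next
      case False
      \<comment> \<open>Since \<open>f\<close> preserves \<open>S - ?T\<close>, the four updates are
        never met here.\<close>
      then show ?thesis using z f[of z] by auto
    qed
    then show ?thesis by blast
  qed simp
qed

lemma inverse_ambiguous_iff:
  "inverse_ambiguous f \<longleftrightarrow> (\<forall>x. f (f x) = - x)"
proof
  assume f: "inverse_ambiguous f"
  have "f (- f x) = x" for x
    using f unfolding inverse_ambiguous_def by (metis bij_inv_eq_iff)
  moreover have "- f (f x) = x" for x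
    using f unfolding inverse_ambiguous_def by (metis bij_inv_eq_iff)
  ultimately show "\<forall>x. f (f x) = - x" by (metis minus_minus)
next
  assume f: "\<forall>x. f (f x) = - x"
  \<comment> \<open>Both sides equal \<open>f (f (f x))\<close>.\<close>
  then have comm: "f (- x) = - f x" for x by metis
  have "bij f"
    by (rule o_bij[of "\<lambda>x. - f x"]) (auto simp: fun_eq_iff f comm)
  moreover have "inv f x = - f x" for x
    by (rule inv_f_eq[OF bij_is_inj[OF \<open>bij f\<close>]]) (simp add: f comm)
  ultimately show "inverse_ambiguous f" by (simp add: inverse_ambiguous_def)
qed

text \<open>Translation by an element of order two would be an involution without fixed
  points.\<close>

lemma add_self_nonzero_of_odd_card:
  fixes v :: "'a::group_add"
  assumes "odd (CARD('a))" and "v \<noteq> 0"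
  shows "v + v \<noteq> 0"
proof
  assume v: "v + v = 0"
  \<comment> \<open>An infinite type has cardinality 0 by convention, which is even.\<close>
  have "finite (UNIV :: 'a set)" using assms(1) by (metis card.infinite even_zero)
  moreover have "x + v \<noteq> x" for x
    using assms(2) add_left_imp_eq[of x v 0] by auto
  ultimately have "even (CARD('a))"
    by (intro even_card_involution[where h = "\<lambda>x. x + v"]) (simp_all add: add.assoc v)
  with assms(1) show False by simp
qed

text \<open>Otherwise negation pairs off the nonzero elements, and together with 0 their number is
  odd.\<close>

lemma two_eq_zero_of_even_card:
  assumes "even (CARD('k::{field,finite}))"
  shows "(1::'k) + 1 = 0"
proof (rule ccontr)
  assume two: "(1::'k) + 1 \<noteq> 0"
  have "even (card (UNIV - {0::'k}))"
  proof (rule even_card_involution[where h = uminus])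
    fix x :: 'k
    assume "x \<in> UNIV - {0}"
    moreover have "- x \<noteq> x" if "x \<noteq> 0"
    proof
      assume "- x = x"
      then have "(1 + 1) * x = 0" by (simp add: distrib_right eq_neg_iff_add_eq_0[symmetric])
      with two that show False by simp
    qed
    ultimately show "- x \<in> UNIV - {0} \<and> - (- x) = x \<and> - x \<noteq> x" by auto
  qed simp
  moreover have "card (UNIV - {0::'k}) + 1 = CARD('k)"
    by (simp add: card_Diff_subset Suc_leI)
  ultimately show False using assms by presburger
qed

lemma inverse_ambiguous_exists_iff_of_odd_card:
  assumes odd: "odd (CARD('a::group_add))"
  shows "(\<exists>f :: 'a \<Rightarrow> 'a. inverse_ambiguous f) \<longleftrightarrow> [CARD('a) = 1] (mod 4)"
proof -
  have fin: "finite (UNIV :: 'a set)" using odd by (metis card.infinite even_zero)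
  have neg: "- x \<noteq> x" if "x \<noteq> 0" for x :: 'a
    using add_self_nonzero_of_odd_card[OF odd that] by (metis add.left_inverse)
  let ?S = "UNIV - {0::'a}"
  have "CARD('a) = Suc (card ?S)"
    using fin by (intro card.remove) auto
  then have cong: "[CARD('a) = 1] (mod 4) \<longleftrightarrow> 4 dvd card ?S"
    by (simp add: cong_def) presburger
  show ?thesis unfolding cong inverse_ambiguous_iff
  proof
    assume "\<exists>f :: 'a \<Rightarrow> 'a. \<forall>x. f (f x) = - x"
    then obtain f :: "'a \<Rightarrow> 'a" where f: "f (f x) = - x" for x by blast
    \<comment> \<open>Evaluate \<open>f (f (f 0))\<close> in two ways, using
      \<open>f (f 0) = 0\<close>.\<close>
    have "f 0 = - f 0" by (metis f minus_zero)
    then have f0: "f 0 = 0" using neg by metis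
    show "4 dvd card ?S"
    proof (rule four_dvd_card_order_four[where f = f])
      fix x :: 'a
      assume "x \<in> ?S"
      then have "x \<noteq> 0" by simp
      moreover from this have "f x \<noteq> 0" using f[of x] f0 by auto
      ultimately show "f x \<in> ?S \<and> f (f (f (f x))) = x \<and> f (f x) \<noteq> x"
        by (simp add: f neg)
    qed (use fin in simp)
  next
    assume "4 dvd card ?S"
    then obtain f where f: "\<And>x. x \<in> ?S \<Longrightarrow> f x \<in> ?S \<and> f (f x) = - x"
      using involution_has_square_root[of ?S uminus] fin neg by auto
    \<comment> \<open>Nonzero elements stay nonzero under \<open>f\<close>, so fixing 0 does not
      disturb the cycles.\<close>
    have "(f(0 := 0)) ((f(0 := 0)) x) = - x" for x
      using f[of x] by auto
    then show "\<exists>f :: 'a \<Rightarrow> 'a. \<forall>x. f (f x) = - x" by blast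
  qed
qed

text \<open>Coordinates with respect to \<open>B\<close> put the vectors in bijection with the
  functions from \<open>B\<close> to the field. Taking these functions extensional makes the
  coefficients of a vector unique as a function.\<close>

lemma card_finite_dimensional_vector_space:
  fixes scale :: "'k::{field,finite} \<Rightarrow> 'v::ab_group_add \<Rightarrow> 'v"
  assumes "finite_dimensional_vector_space scale B"
  shows "CARD('v) = CARD('k) ^ vector_space.dim scale (UNIV :: 'v set)"
proof -
  interpret finite_dimensional_vector_space scale B by fact
  let ?F = "B \<rightarrow>\<^sub>E (UNIV :: 'k set)"
  let ?lin = "\<lambda>g. \<Sum>b\<in>B. scale (g b) b"
  have "bij_betw ?lin ?F UNIV"
  proof (rule bij_betw_imageI)
    show "inj_on ?lin ?F"
    proof (rule inj_onI)
      fix g h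
      assume g: "g \<in> ?F" and h: "h \<in> ?F" and eq: "?lin g = ?lin h"
      have "(\<Sum>b\<in>B. scale (g b - h b) b) = 0"
        using eq by (simp add: scale_left_diff_distrib sum_subtractf)
      then have "g b = h b" if "b \<in> B" for b
        using independentD[OF independent_Basis finite_Basis subset_refl, of "\<lambda>b. g b - h b" b] that by simp
      then show "g = h" using g h by (metis PiE_ext)
    qed
    show "?lin ` ?F = UNIV"
    proof (rule equalityI[OF subset_UNIV], rule subsetI)
      fix v
      obtain u where "v = ?lin u"
        using span_finite[OF finite_Basis] span_Basis by auto
      then have "v = ?lin (restrict u B)" by simp
      moreover have "restrict u B \<in> ?F" by simp
      ultimately show "v \<in> ?lin ` ?F" by blast
    qed
  qed
  then have "CARD('v) = card ?F" by (rule bij_betw_same_card[symmetric])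
  also have "\<dots> = CARD('k) ^ card B" by (simp add: card_PiE finite_Basis)
  finally show ?thesis by (simp add: dim_UNIV dimension_def)
qed

theorem theorem4p1:
  fixes scale :: "'k::{field,finite} \<Rightarrow> 'v::ab_group_add \<Rightarrow> 'v"
    and B :: "'v set"
    and p m q n :: nat
  assumes "prime p" and "m \<ge> 1" and "q = p ^ m"
    and "CARD('k) = q"
    and "finite_dimensional_vector_space scale B"
    and "vector_space.dim scale (UNIV :: 'v set) = n"
  shows "(even q \<or> [q = 1] (mod 4) \<longrightarrow>
           (\<exists>f :: 'v \<Rightarrow> 'v.
              continuous_map (discrete_topology UNIV) (discrete_topology UNIV) f \<and>
              inverse_ambiguous f)) \<and>
         ([q = 3] (mod 4) \<longrightarrow>
           ((\<exists>f :: 'v \<Rightarrow> 'v.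
              continuous_map (discrete_topology UNIV) (discrete_topology UNIV) f \<and>
              inverse_ambiguous f) \<longleftrightarrow> even n))"
proof -
  interpret finite_dimensional_vector_space scale B by fact
  have card: "CARD('v) = q ^ n"
    using card_finite_dimensional_vector_space[OF assms(5)] assms(4,6) by simp
  have even_case: "\<exists>f :: 'v \<Rightarrow> 'v. inverse_ambiguous f" if "even q"
  proof -
    have "(1::'k) + 1 = 0" using two_eq_zero_of_even_card that assms(4) by metis
    \<comment> \<open>In characteristic two every vector is its own negative, so the identity is a
      square root of negation.\<close>
    then have "v + v = 0" for v :: 'v
      by (metis scale_left_distrib scale_one scale_zero_left)
    then have "inverse_ambiguous (id :: 'v \<Rightarrow> 'v)"
      by (simp add: inverse_ambiguous_iff eq_neg_iff_add_eq_0)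
    then show ?thesis by blast
  qed
  have odd_case: "(\<exists>f :: 'v \<Rightarrow> 'v. inverse_ambiguous f) \<longleftrightarrow> [q ^ n = 1] (mod 4)" if "odd q"
    using inverse_ambiguous_exists_iff_of_odd_card[where 'a = 'v] that card by simp
  have one: "odd q \<and> [q ^ n = 1] (mod 4)" if "[q = 1] (mod 4)"
  proof
    show "odd q" using that unfolding cong_def by presburger
    show "[q ^ n = 1] (mod 4)" using cong_pow[OF that, of n] by simp
  qed
  have three: "odd q \<and> ([q ^ n = 1] (mod 4) \<longleftrightarrow> even n)" if q: "[q = 3] (mod 4)"
  proof
    show "odd q" using q unfolding cong_def by presburger
    \<comment> \<open>Modulo 4, \<open>q\<close> is -1, so its powers alternate between 1 and
      3.\<close>
    have "q ^ n mod 4 = (if even n then 1 else 3)"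
    proof (induction n)
      case (Suc n)
      have "q ^ Suc n mod 4 = (q mod 4) * (q ^ n mod 4) mod 4" by (simp add: mod_mult_eq)
      with Suc q show ?case by (simp add: cong_def)
    qed simp
    then show "[q ^ n = 1] (mod 4) \<longleftrightarrow> even n" by (simp add: cong_def)
  qed
  \<comment> \<open>Continuity between discrete spaces is automatic, which leaves only the algebraic
    statements.\<close>
  show ?thesis
    using even_case odd_case one three by auto
qed

end
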